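(* The binary operation $\star$ on the set of positive real numbers (defined in the context via the arithmetic-geometric mean $\mathrm{agm}$ and the theta function $\theta$) satisfies the following properties, where $x, y$ denote positive real numbers. (A) $1 \star x = x$ for all $x$. Hence $1$ is the unit element of the operation. (B) $x \star x = y \star y$ implies $x = y$. (C) $x \star y = \mathrm{agm}(x,y) \star \mathrm{agm}(x,y)$ for all $x, y$. Thus the mean of $x$ and $y$ with respect to the operation $\star$ (the positive number $\mu$ with $x \star y = \mu \star \mu$) is $\mathrm{agm}(x,y)$.
   Context: For positive real numbers $x, y$, the arithmetic-geometric mean $\mathrm{agm}(x,y)$ is defined as follows: put $x_0 = x$, $y_0 = y$, and $x_n = (x_{n-1}+y_{n-1})/2$, $y_n = \sqrt{x_{n-1}y_{n-1}}$ for $n \ge 1$; then $\mathrm{agm}(x,y) = \lim_{n\to\infty} x_n = \lim_{n\to\infty} y_n$ (the common limit, which is positive). For $-1 < q < 1$ let $\theta(q) = \sum_{n=-\infty}^{+\infty} q^{n^2} = 1 + 2\sum_{n=1}^{\infty} q^{n^2}$, and write $\theta^2(q)$ for $(\theta(q))^2$. The function $\theta$ is strictly increasing on $(-1,1)$, with $\lim_{q\to -1}\theta(q) = 0$, $\theta(0)=1$, $\lim_{q\to 1}\theta(q) = +\infty$. The operation $\star$ on the set of positive real numbers: for positive real $x, y$, let $q \in (-1,1)$ be the unique number such that $1/\mathrm{agm}(x,y) = \theta^2(q)$, and define $x \star y = \theta^2(-q)/\theta^2(q)$. (The operation is commutative, since $\mathrm{agm}(x,y)=\mathrm{agm}(y,x)$.)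 *)

theory Defs
  imports "HOL-Analysis.Analysis"
begin

primrec agm_seq :: "real \<Rightarrow> real \<Rightarrow> nat \<Rightarrow> real \<times> real" where
  "agm_seq x y 0 = (x, y)"
| "agm_seq x y (Suc n) =
     (let (a, b) = agm_seq x y n in ((a + b) / 2, sqrt (a * b)))"

definition agm :: "real \<Rightarrow> real \<Rightarrow> real" where
  "agm x y = (THE l. (\<lambda>n. fst (agm_seq x y n)) \<longlonglongrightarrow> l \<and>
                     (\<lambda>n. snd (agm_seq x y n)) \<longlonglongrightarrow> l)"

(* Only meaningful for -1 < q < 1. The term for n = 0 is 1, also when q = 0. *)
definition theta :: "real \<Rightarrow> real" where
  "theta q = (\<Sum>\<^sub>\<infinity>n::int. q powi (n\<^sup>2))"

(* For x, y > 0 there is exactly one such q, because theta is a strictly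
   increasing bijection from (-1, 1) onto the positive reals. *)
definition agm_nome :: "real \<Rightarrow> real \<Rightarrow> real" where
  "agm_nome x y = (THE q. -1 < q \<and> q < 1 \<and> 1 / agm x y = (theta q)\<^sup>2)"

definition agm_star :: "real \<Rightarrow> real \<Rightarrow> real" (infixl "\<star>" 70) where
  "x \<star> y = (theta (- agm_nome x y))\<^sup>2 / (theta (agm_nome x y))\<^sup>2"

end

theory Submission
  imports Defs
begin

text \<open>
  The key is that theta values parametrize the arithmetic-geometric mean. Expanding products of
  theta series as double sums over pairs of integers and sorting the terms by the parity of the
  coordinate sum gives the two duplication identities

    \<open>((theta q)\<^sup>2 + (theta (- q))\<^sup>2) / 2 = (theta (q\<^sup>2))\<^sup>2\<close> and
    \<open>theta q * theta (- q) = (theta (- (q\<^sup>2)))\<^sup>2\<close>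

  (\<open>theta_mean_identity\<close>, \<open>theta_mult_identity\<close>). So an agm step applied to \<open>(theta q)\<^sup>2\<close>,
  \<open>(theta (- q))\<^sup>2\<close> replaces \<open>q\<close> by \<open>q\<^sup>2\<close>. Iterating drives the nome to \<open>0\<close>, where theta is \<open>1\<close>; hence
  the agm of the pair is \<open>1\<close>, and by homogeneity
  \<open>agm 1 ((theta (- q))\<^sup>2 / (theta q)\<^sup>2) = 1 / (theta q)\<^sup>2\<close> (\<open>agm_one_theta_ratio\<close>).

  This relation gives the unit law: if \<open>x = (theta (- q))\<^sup>2 / (theta q)\<^sup>2\<close>, then \<open>q\<close> is the nome belonging to
  \<open>1\<close> and \<open>x\<close>, and so \<open>1 \<star> x\<close> is that same quotient. It applies to every positive \<open>x\<close>
  because the quotient is a continuous function of \<open>q\<close> taking all positive values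
  (\<open>theta_ratio_surj\<close>). Since the operation depends on its arguments only through their agm, and
  \<open>agm a a = a\<close>, replacing both arguments by their agm changes nothing. Finally \<open>x \<star> x\<close>
  determines the nome, as the quotient is strictly decreasing, and the nome determines
  \<open>agm x x = x\<close>.

  It remains to know that theta is a strictly increasing bijection from the open interval onto
  the positive reals, so that the nome exists and is unique. For \<open>q \<ge> 0\<close> the growth of theta can
  be read off from its series. For negative nome the same facts are derived from the duplication
  identities and the agm: theta has no zero because the agm iteration has limit \<open>1\<close>, it is
  monotone because the agm is (\<open>theta_minus_antimono_nonneg\<close>), and it tends to \<open>0\<close> at \<open>-1\<close> because
  \<open>theta (- q) \<le> 1 / theta q\<close>.
\<close>

section \<open>Theta as a sum over the integers and as a power series\<close>

lemma powi_square: "(q::real) powi (n\<^sup>2) = q ^ nat (n\<^sup>2)"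
  by (simp add: power_int_def)

text \<open>
  Since \<open>n\<^sup>2\<close> has the parity of \<open>n\<close>, passing from \<open>q\<close> to \<open>- q\<close> only changes the
  signs of the odd terms of the theta series. This is what makes the duplication identities
  a matter of parity.
\<close>

lemma uminus_power_square:
  "(- q :: real) ^ nat (n\<^sup>2) = (if even n then 1 else - 1) * q ^ nat (n\<^sup>2)"
proof -
  have "even (nat (n\<^sup>2)) \<longleftrightarrow> even n"
    by (simp add: even_nat_iff)
  then show ?thesis
    by simp
qed

lemma summable_power_Suc_square:
  fixes q :: real
  assumes "\<bar>q\<bar> < 1"
  shows "summable (\<lambda>n. norm (q ^ (Suc n)\<^sup>2))"
proof (rule summable_comparison_test')
  show "summable (\<lambda>n. \<bar>q\<bar> ^ n)"
    using assms by (simp add: summable_geometric)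
  show "norm (norm (q ^ (Suc n)\<^sup>2)) \<le> \<bar>q\<bar> ^ n" if "n \<ge> 0" for n
  proof -
    have "n \<le> (Suc n)\<^sup>2"
      by (simp add: power2_eq_square)
    then show ?thesis
      using assms by (simp add: power_abs power_decreasing)
  qed
qed

lemma has_sum_power_square:
  fixes q :: real
  assumes "\<bar>q\<bar> < 1"
  shows "((\<lambda>n::int. q ^ nat (n\<^sup>2)) has_sum (1 + 2 * (\<Sum>n. q ^ (Suc n)\<^sup>2))) UNIV"
proof -
  define S where "S = (\<Sum>n. q ^ (Suc n)\<^sup>2)"
  have "(\<lambda>n. q ^ (Suc n)\<^sup>2) sums S"
    unfolding S_def using summable_power_Suc_square[OF assms]
    by (blast intro: summable_sums summable_norm_cancel)
  then have S: "((\<lambda>n. q ^ (Suc n)\<^sup>2) has_sum S) UNIV"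
    using norm_summable_imp_has_sum[OF summable_power_Suc_square[OF assms]] by blast
  let ?f = "\<lambda>n::int. q ^ nat (n\<^sup>2)"
  have pos: "(?f has_sum S) {0<..}"
  proof -
    have "(?f has_sum S) {0<..} = ((\<lambda>n. q ^ (Suc n)\<^sup>2) has_sum S) UNIV"
      by (rule has_sum_reindex_bij_witness[where i = "\<lambda>n. int (Suc n)" and j = "\<lambda>m. nat m - 1"])
         (auto simp: nat_power_eq)
    with S show ?thesis by simp
  qed
  have neg: "(?f has_sum S) {..<0}"
  proof -
    have "(?f has_sum S) {..<0} = (?f has_sum S) {0<..}"
      by (rule has_sum_reindex_bij_witness[where i = uminus and j = uminus]) auto
    with pos show ?thesis by simp
  qed
  have "(?f has_sum (1 + S)) ({0} \<union> {0<..})"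
    by (rule has_sum_Un_disjoint) (use pos in \<open>auto intro!: has_sum_finiteI\<close>)
  then have "(?f has_sum ((1 + S) + S)) (({0} \<union> {0<..}) \<union> {..<0})"
    by (rule has_sum_Un_disjoint) (use neg in auto)
  moreover have "({0} \<union> {0<..}) \<union> {..<0} = (UNIV :: int set)"
    by auto
  ultimately show ?thesis
    by (simp add: S_def add_ac)
qed

lemma theta_eq_suminf:
  assumes "\<bar>q\<bar> < 1"
  shows "theta q = 1 + 2 * (\<Sum>n. q ^ (Suc n)\<^sup>2)"
  using infsumI[OF has_sum_power_square[OF assms]] by (simp add: theta_def powi_square)

lemma has_sum_theta:
  assumes "\<bar>q\<bar> < 1"
  shows "((\<lambda>n::int. q ^ nat (n\<^sup>2)) has_sum theta q) UNIV"
  using has_sum_power_square[OF assms] theta_eq_suminf[OF assms] by simp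

section \<open>The duplication identities of theta\<close>

lemma has_sum_prod:
  fixes f :: "'a \<Rightarrow> real" and g :: "'b \<Rightarrow> real"
  assumes f: "(f has_sum a) UNIV" and g: "(g has_sum b) UNIV"
  shows "((\<lambda>(m, n). f m * g n) has_sum (a * b)) UNIV"
proof -
  have "(\<lambda>m. norm (f m)) summable_on UNIV" "(\<lambda>n. norm (g n)) summable_on UNIV"
    using f g has_sum_imp_summable summable_on_iff_abs_summable_on_real by blast+
  then have "(\<lambda>x. norm ((\<lambda>(m, n). f m * g n) x)) summable_on (UNIV \<times> UNIV)"
    by (subst Infinite_Sum.abs_summable_on_Sigma_iff)
       (auto simp: abs_mult infsum_cmult_right' intro!: summable_on_cmult_right summable_on_cmult_left)
  then have "(\<lambda>(m, n). f m * g n) summable_on (UNIV \<times> UNIV)"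
    by (rule abs_summable_summable)
  then have "((\<lambda>(m, n). f m * g n) has_sum (a * b)) (UNIV \<times> UNIV)"
    by (intro has_sum_SigmaI[where g = "\<lambda>m. f m * b"])
       (auto intro: has_sum_cmult_right has_sum_cmult_left f g)
  then show ?thesis by simp
qed

lemma theta_mult_has_sum:
  assumes "\<bar>q\<bar> < 1" "\<bar>p\<bar> < 1"
  shows "((\<lambda>(m, n). q ^ nat (m\<^sup>2) * p ^ nat (n\<^sup>2)) has_sum (theta q * theta p)) UNIV"
  using has_sum_prod[OF has_sum_theta has_sum_theta] assms by blast

text \<open>
  The index set of the terms that survive in \<open>(theta q)\<^sup>2 + (theta (- q))\<^sup>2\<close> and in
  \<open>theta q * theta (- q)\<close>.
\<close>

definition parity_lattice :: "(int \<times> int) set" where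
  "parity_lattice = {(m, n). even (m + n)}"

text \<open>
  Rotating the plane by 45 degrees and scaling by \<open>sqrt 2\<close> maps the square lattice onto the
  sublattice of points with even coordinate sum, so a sum over the sublattice is again a sum
  over all pairs of integers.
\<close>

lemma has_sum_parity_lattice_iff:
  "(f has_sum s) parity_lattice \<longleftrightarrow> ((\<lambda>(a, b). f (a + b, a - b)) has_sum s) UNIV"
proof (rule has_sum_reindex_bij_witness[where i = "\<lambda>(a, b). (a + b, a - b)"
      and j = "\<lambda>(m, n). ((m + n) div 2, (m - n) div 2)"])
  have half: "(m + n) div 2 + (m - n) div 2 = m" "(m + n) div 2 - (m - n) div 2 = n"
    if "even (m + n)" for m n :: int
    using that by presburger+
  fix x :: "int \<times> int"
  assume "x \<in> parity_lattice"
  then obtain m n where x: "x = (m, n)" and mn: "even (m + n)"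
    by (auto simp: parity_lattice_def)
  show "(case case x of (m, n) \<Rightarrow> ((m + n) div 2, (m - n) div 2) of (a, b) \<Rightarrow> (a + b, a - b)) = x"
    using half[OF mn] by (simp add: x del: even_add)
  show "(case case x of (m, n) \<Rightarrow> ((m + n) div 2, (m - n) div 2) of (a, b) \<Rightarrow> f (a + b, a - b)) = f x"
    using half[OF mn] by (simp add: x del: even_add)
qed (auto simp: parity_lattice_def)

text \<open>
  The scaling doubles \<open>m\<^sup>2 + n\<^sup>2\<close>; this is where the nome \<open>q\<^sup>2\<close> comes from.
\<close>

lemma rotated_weight:
  "(q::real) ^ nat ((a + b)\<^sup>2) * q ^ nat ((a - b)\<^sup>2) = (q\<^sup>2) ^ nat (a\<^sup>2) * (q\<^sup>2) ^ nat (b\<^sup>2)"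
proof -
  have "(a + b)\<^sup>2 + (a - b)\<^sup>2 = 2 * (a\<^sup>2 + b\<^sup>2)"
    by (simp add: power2_eq_square algebra_simps)
  then have "nat ((a + b)\<^sup>2 + (a - b)\<^sup>2) = nat (2 * (a\<^sup>2 + b\<^sup>2))"
    by simp
  then have "nat ((a + b)\<^sup>2) + nat ((a - b)\<^sup>2) = 2 * (nat (a\<^sup>2) + nat (b\<^sup>2))"
    by (simp add: nat_add_distrib nat_mult_distrib del: power2_sum power2_diff)
  then show ?thesis
    by (metis power_add power_mult)
qed

lemma square_less_one: "\<bar>q\<bar> < 1 \<Longrightarrow> \<bar>q\<^sup>2\<bar> < (1::real)"
  by (simp add: abs_square_less_1)

lemma theta_square_sum_parity_lattice:
  assumes "\<bar>q\<bar> < 1"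
  shows "((\<lambda>(m, n). q ^ nat (m\<^sup>2) * q ^ nat (n\<^sup>2)) has_sum (theta (q\<^sup>2))\<^sup>2) parity_lattice"
  using theta_mult_has_sum[OF square_less_one square_less_one, OF assms assms]
  by (simp add: has_sum_parity_lattice_iff rotated_weight power2_eq_square[of "theta _"])

text \<open>
  The double series of \<open>(theta q)\<^sup>2\<close> and \<open>(theta (- q))\<^sup>2\<close> have the same terms except for the sign
  \<open>(-1) ^ (m + n)\<close>, so their mean is the part over the parity lattice.
\<close>

lemma theta_mean_identity:
  assumes "\<bar>q\<bar> < 1"
  shows "((theta q)\<^sup>2 + (theta (- q))\<^sup>2) / 2 = (theta (q\<^sup>2))\<^sup>2"
proof -
  let ?F = "\<lambda>(m::int, n::int). q ^ nat (m\<^sup>2) * q ^ nat (n\<^sup>2)"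
  have 1: "(?F has_sum (theta q)\<^sup>2) UNIV"
    using theta_mult_has_sum[OF assms assms] by (simp add: power2_eq_square[of "theta _"])
  have 2: "((\<lambda>(m::int, n::int). (- q) ^ nat (m\<^sup>2) * (- q) ^ nat (n\<^sup>2)) has_sum (theta (- q))\<^sup>2) UNIV"
    using theta_mult_has_sum[of "- q" "- q"] assms by (simp add: power2_eq_square[of "theta _"])
  have "((\<lambda>x. if x \<in> parity_lattice then 2 * ?F x else 0) has_sum ((theta q)\<^sup>2 + (theta (- q))\<^sup>2)) UNIV"
    using has_sum_add[OF 1 2]
  proof (rule has_sum_cong[THEN iffD1, rotated])
    fix x :: "int \<times> int"
    obtain m n where "x = (m, n)" by fastforce
    then show "?F x + (\<lambda>(m::int, n::int). (- q) ^ nat (m\<^sup>2) * (- q) ^ nat (n\<^sup>2)) x = (if x \<in> parity_lattice then 2 * ?F x else 0)"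
      by (cases "even m"; cases "even n") (simp_all add: uminus_power_square parity_lattice_def)
  qed
  moreover have "((\<lambda>x. if x \<in> parity_lattice then 2 * ?F x else 0) has_sum (2 * (theta (q\<^sup>2))\<^sup>2)) UNIV"
    using has_sum_cmult_right[OF theta_square_sum_parity_lattice[OF assms], of 2]
    by (rule has_sum_cong_neutral[THEN iffD1, rotated -1]) auto
  ultimately have "(theta q)\<^sup>2 + (theta (- q))\<^sup>2 = 2 * (theta (q\<^sup>2))\<^sup>2"
    by (rule has_sum_unique)
  then show ?thesis by simp
qed

text \<open>
  Here the terms off the parity lattice cancel in pairs: exchanging \<open>m\<close> and \<open>n\<close> moves the sign
  from the even to the odd index. The proof adds the series to its transpose to express this
  cancellation.
\<close>

lemma theta_mult_identity:
  assumes "\<bar>q\<bar> < 1"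
  shows "theta q * theta (- q) = (theta (- (q\<^sup>2)))\<^sup>2"
proof -
  let ?G = "\<lambda>(m::int, n::int). q ^ nat (m\<^sup>2) * (- q) ^ nat (n\<^sup>2)"
  have G: "(?G has_sum (theta q * theta (- q))) UNIV"
    using theta_mult_has_sum[of q "- q"] assms by simp
  have swap: "((\<lambda>(m, n). ?G (n, m)) has_sum (theta q * theta (- q))) UNIV"
    using G by (rule has_sum_reindex_bij_witness[where i = prod.swap and j = prod.swap, THEN iffD1, rotated -1])
      auto
  have "((\<lambda>x. if x \<in> parity_lattice then 2 * ?G x else 0) has_sum (2 * (theta q * theta (- q)))) UNIV"
    using has_sum_add[OF G swap] unfolding mult_2[of "theta q * theta (- q)"]
  proof (rule has_sum_cong[THEN iffD1, rotated])
    fix x :: "int \<times> int"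
    obtain m n where "x = (m, n)" by fastforce
    then show "?G x + (\<lambda>(m, n). ?G (n, m)) x = (if x \<in> parity_lattice then 2 * ?G x else 0)"
      by (cases "even m"; cases "even n") (simp_all add: uminus_power_square parity_lattice_def)
  qed
  moreover have "((\<lambda>x. if x \<in> parity_lattice then 2 * ?G x else 0) has_sum (2 * (theta (- (q\<^sup>2)))\<^sup>2)) UNIV"
  proof -
    have eq: "?G (a + b, a - b) = (- (q\<^sup>2)) ^ nat (a\<^sup>2) * (- (q\<^sup>2)) ^ nat (b\<^sup>2)" for a b
      using rotated_weight[of q a b] by (auto simp: uminus_power_square)
    have "(?G has_sum (theta (- (q\<^sup>2)))\<^sup>2) parity_lattice"
      using theta_mult_has_sum[of "- (q\<^sup>2)" "- (q\<^sup>2)"] square_less_one[OF assms] eq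
      by (simp add: has_sum_parity_lattice_iff power2_eq_square[of "theta _"])
    from has_sum_cmult_right[OF this, of 2] show ?thesis
      by (rule has_sum_cong_neutral[THEN iffD1, rotated -1]) auto
  qed
  ultimately have "2 * (theta q * theta (- q)) = 2 * (theta (- (q\<^sup>2)))\<^sup>2"
    by (rule has_sum_unique)
  then show ?thesis by simp
qed

section \<open>The arithmetic-geometric mean\<close>

lemma agm_seq_positive:
  assumes "x > 0" "y > 0"
  shows "fst (agm_seq x y n) > 0 \<and> snd (agm_seq x y n) > 0"
  using assms by (induction n) (auto simp: case_prod_unfold Let_def)

lemma agm_eqI:
  assumes "(\<lambda>n. fst (agm_seq x y n)) \<longlonglongrightarrow> l" "(\<lambda>n. snd (agm_seq x y n)) \<longlonglongrightarrow> l"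
  shows "agm x y = l"
  unfolding agm_def
proof (rule the_equality)
  fix m
  assume "(\<lambda>n. fst (agm_seq x y n)) \<longlonglongrightarrow> m \<and> (\<lambda>n. snd (agm_seq x y n)) \<longlonglongrightarrow> m"
  then show "m = l"
    using assms LIMSEQ_unique by blast
qed (use assms in blast)

text \<open>
  Dropping the two start values makes the sequences nested, whatever the order of \<open>x\<close> and \<open>y\<close>;
  the gap at least halves in each step.
\<close>

lemma agm_seq_converges:
  assumes "x > 0" "y > 0"
  shows "\<exists>l>0. (\<lambda>n. fst (agm_seq x y n)) \<longlonglongrightarrow> l \<and> (\<lambda>n. snd (agm_seq x y n)) \<longlonglongrightarrow> l"
proof -
  define X where "X n = fst (agm_seq x y (Suc n))" for n
  define Y where "Y n = snd (agm_seq x y (Suc n))" for n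
  have pos: "X n > 0" "Y n > 0" for n
    using agm_seq_positive[OF assms, of "Suc n"] by (simp_all only: X_def Y_def)
  have step: "X (Suc n) = (X n + Y n) / 2" "Y (Suc n) = sqrt (X n * Y n)" for n
    by (simp_all add: X_def Y_def case_prod_unfold Let_def)
  have le: "Y n \<le> X n" for n
    using agm_seq_positive[OF assms, of n]
      arith_geo_mean_sqrt[of "fst (agm_seq x y n)" "snd (agm_seq x y n)"]
    by (simp add: X_def Y_def case_prod_unfold Let_def)
  have dec: "X (Suc n) \<le> X n" for n
    using le[of n] by (simp add: step)
  have inc: "Y n \<le> Y (Suc n)" for n
  proof -
    have "Y n = sqrt (Y n * Y n)"
      using pos(2)[of n] by simp
    also have "\<dots> \<le> Y (Suc n)"
      unfolding step using le[of n] pos(2)[of n] by (intro real_sqrt_le_mono mult_right_mono) auto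
    finally show ?thesis .
  qed
  have gap: "X n - Y n \<le> (X 0 - Y 0) * (1 / 2) ^ n" for n
  proof (induction n)
    case (Suc n)
    have "X (Suc n) - Y (Suc n) \<le> (X n - Y n) / 2"
      using inc[of n] step(1)[of n] by (simp add: field_simps)
    with Suc show ?case by simp
  qed simp
  have "(\<lambda>n. (X 0 - Y 0) * (1 / 2) ^ n) \<longlonglongrightarrow> 0"
    by (intro tendsto_mult_right_zero LIMSEQ_power_zero) simp
  then have "(\<lambda>n. X n - Y n) \<longlonglongrightarrow> 0"
    by (rule tendsto_sandwich[OF _ _ tendsto_const, rotated -1]) (use gap le in auto)
  then have "(\<lambda>n. Y n - X n) \<longlonglongrightarrow> 0"
    using tendsto_minus by fastforce
  then obtain l where l: "\<forall>n. Y n \<le> l" "Y \<longlonglongrightarrow> l" "X \<longlonglongrightarrow> l"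
    using nested_sequence_unique[of Y X] inc dec le by blast
  have "l > 0"
    using l(1) pos(2)[of 0] by (metis less_le_trans)
  moreover have "(\<lambda>n. fst (agm_seq x y n)) \<longlonglongrightarrow> l"
    using l(3) unfolding X_def by (rule LIMSEQ_imp_Suc)
  moreover have "(\<lambda>n. snd (agm_seq x y n)) \<longlonglongrightarrow> l"
    using l(2) unfolding Y_def by (rule LIMSEQ_imp_Suc)
  ultimately show ?thesis by blast
qed

lemma
  assumes "x > 0" "y > 0"
  shows agm_positive: "agm x y > 0"
    and fst_agm_seq_tendsto: "(\<lambda>n. fst (agm_seq x y n)) \<longlonglongrightarrow> agm x y"
    and snd_agm_seq_tendsto: "(\<lambda>n. snd (agm_seq x y n)) \<longlonglongrightarrow> agm x y"
proof -
  obtain l where l: "l > 0" "(\<lambda>n. fst (agm_seq x y n)) \<longlonglongrightarrow> l" "(\<lambda>n. snd (agm_seq x y n)) \<longlonglongrightarrow> l"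
    using agm_seq_converges[OF assms] by blast
  moreover from l(2,3) have "agm x y = l"
    by (rule agm_eqI)
  ultimately show "agm x y > 0"
    "(\<lambda>n. fst (agm_seq x y n)) \<longlonglongrightarrow> agm x y" "(\<lambda>n. snd (agm_seq x y n)) \<longlonglongrightarrow> agm x y"
    by simp_all
qed

lemma agm_same:
  assumes "x > 0"
  shows "agm x x = x"
proof -
  have "agm_seq x x n = (x, x)" for n
    using assms by (induction n) auto
  then show ?thesis by (intro agm_eqI) auto
qed

text \<open>
  Exchanging the arguments changes only the first pair of the iteration.
\<close>

lemma agm_commute:
  assumes "x > 0" "y > 0"
  shows "agm x y = agm y x"
proof (rule sym, rule agm_eqI)
  have eq: "agm_seq y x (Suc n) = agm_seq x y (Suc n)" for n
    by (induction n) (simp_all add: add.commute mult.commute)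
  show "(\<lambda>n. fst (agm_seq y x n)) \<longlonglongrightarrow> agm x y"
    using LIMSEQ_Suc[OF fst_agm_seq_tendsto[OF assms]] unfolding eq[symmetric] by (rule LIMSEQ_imp_Suc)
  show "(\<lambda>n. snd (agm_seq y x n)) \<longlonglongrightarrow> agm x y"
    using LIMSEQ_Suc[OF snd_agm_seq_tendsto[OF assms]] unfolding eq[symmetric] by (rule LIMSEQ_imp_Suc)
qed

lemma agm_scale:
  assumes "c > 0" "x > 0" "y > 0"
  shows "agm (c * x) (c * y) = c * agm x y"
proof -
  have "agm_seq (c * x) (c * y) n = (c * fst (agm_seq x y n), c * snd (agm_seq x y n))" for n
    using assms(1)
    by (induction n)
       (auto simp: case_prod_unfold Let_def real_sqrt_mult algebra_simps add_divide_distrib)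
  then show ?thesis
    using fst_agm_seq_tendsto[OF assms(2,3)] snd_agm_seq_tendsto[OF assms(2,3)]
    by (intro agm_eqI) (auto intro: tendsto_mult_left)
qed

lemma agm_mono:
  assumes "0 < x" "x \<le> x'" "0 < y" "y \<le> y'"
  shows "agm x y \<le> agm x' y'"
proof -
  have "fst (agm_seq x y n) \<le> fst (agm_seq x' y' n) \<and> snd (agm_seq x y n) \<le> snd (agm_seq x' y' n)" for n
  proof (induction n)
    case (Suc n)
    then show ?case
      using agm_seq_positive[OF assms(1,3), of n]
      by (auto simp: case_prod_unfold Let_def intro!: mult_mono add_mono divide_right_mono)
  qed (use assms in auto)
  then show ?thesis
    using LIMSEQ_le[OF fst_agm_seq_tendsto[of x y] fst_agm_seq_tendsto[of x' y']] assms by auto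
qed

section \<open>Continuity of theta and the agm iteration\<close>

lemma power_power_two_less_one: "\<bar>q\<bar> < 1 \<Longrightarrow> \<bar>q ^ 2 ^ n\<bar> < (1::real)"
  using power_strict_mono[of "\<bar>q\<bar>" 1 "2 ^ n"] by (simp add: power_abs)

lemma continuous_on_theta: "continuous_on {-1<..<1} theta"
proof -
  \<comment> \<open>The series converges uniformly on compact subintervals, dominated by its values at \<open>r\<close>.\<close>
  have "continuous_on {-r..r} theta" if r: "0 < r" "r < 1" for r
  proof -
    have bd: "norm (q ^ (Suc n)\<^sup>2) \<le> norm (r ^ (Suc n)\<^sup>2)" if "q \<in> {-r..r}" for q :: real and n
      using that r by (auto simp: power_abs intro!: power_mono)
    have "uniform_limit {-r..r} (\<lambda>N q. \<Sum>n<N. q ^ (Suc n)\<^sup>2) (\<lambda>q. \<Sum>n. q ^ (Suc n)\<^sup>2) sequentially"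
      by (rule Weierstrass_m_test[OF bd summable_power_Suc_square]) (use r in auto)
    then have "continuous_on {-r..r} (\<lambda>q. \<Sum>n. q ^ (Suc n)\<^sup>2)"
      by (rule uniform_limit_theorem[rotated]) (auto intro!: always_eventually continuous_intros)
    then have "continuous_on {-r..r} (\<lambda>q. 1 + 2 * (\<Sum>n. q ^ (Suc n)\<^sup>2))"
      by (intro continuous_intros)
    then show ?thesis
      by (rule continuous_on_eq) (use r in \<open>auto intro!: theta_eq_suminf[symmetric]\<close>)
  qed
  note cont = this
  have "isCont theta q" if "q \<in> {-1<..<1}" for q
  proof -
    define r where "r = (1 + \<bar>q\<bar>) / 2"
    have r: "0 < r" "r < 1" "-r < q" "q < r"
      using that by (auto simp: r_def abs_if field_simps)
    then show ?thesis
      using continuous_on_interior[OF cont[OF r(1,2)], of q] by simp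
  qed
  then show ?thesis
    by (simp add: continuous_at_imp_continuous_on)
qed

lemma theta_0: "theta 0 = 1"
proof -
  have "(\<lambda>n. (0::real) ^ (Suc n)\<^sup>2) = (\<lambda>n. 0)"
    by (rule ext) simp
  then have "(\<Sum>n. (0::real) ^ (Suc n)\<^sup>2) = 0"
    by (simp only: suminf_zero)
  then show ?thesis
    using theta_eq_suminf[of 0] by simp
qed

lemma theta_tendsto_1:
  assumes "X \<longlonglongrightarrow> 0"
  shows "(\<lambda>n. theta (X n)) \<longlonglongrightarrow> 1"
proof -
  have "isCont theta 0"
    using continuous_on_theta by (simp add: continuous_on_eq_continuous_at)
  then show ?thesis
    using isCont_tendsto_compose[of 0 theta X sequentially] assms by (simp add: theta_0)
qed

lemma power_power_two_tendsto_0: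
  fixes q :: real
  assumes "\<bar>q\<bar> < 1"
  shows "(\<lambda>n. q ^ 2 ^ n) \<longlonglongrightarrow> 0"
proof -
  have "filterlim (\<lambda>n::nat. 2 ^ n :: nat) sequentially sequentially"
    by (intro filterlim_subseq strict_monoI) auto
  then show ?thesis
    using filterlim_compose[OF LIMSEQ_power_zero[of q]] assms by simp
qed

text \<open>
  Squares of theta values uniformize the iteration: one step of the agm is the substitution
  \<open>q \<mapsto> q\<^sup>2\<close> in the pair \<open>((theta q)\<^sup>2, (theta (- q))\<^sup>2)\<close>. The geometric mean comes out right
  whatever the signs of the theta values, because \<open>theta q * theta (- q)\<close> is itself a square.
\<close>

lemma agm_seq_theta:
  assumes "\<bar>q\<bar> < 1"
  shows "agm_seq ((theta q)\<^sup>2) ((theta (- q))\<^sup>2) n =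
    ((theta (q ^ 2 ^ n))\<^sup>2, (theta (- (q ^ 2 ^ n)))\<^sup>2)"
proof (induction n)
  case (Suc n)
  have u: "\<bar>q ^ 2 ^ n\<bar> < 1"
    using assms by (rule power_power_two_less_one)
  have sq: "q ^ 2 ^ Suc n = (q ^ 2 ^ n)\<^sup>2"
    by (simp add: power_mult[symmetric] mult.commute)
  have "sqrt ((theta (q ^ 2 ^ n))\<^sup>2 * (theta (- (q ^ 2 ^ n)))\<^sup>2) = (theta (- ((q ^ 2 ^ n)\<^sup>2)))\<^sup>2"
    unfolding power_mult_distrib[symmetric] theta_mult_identity[OF u]
    by (subst real_sqrt_abs) simp
  then show ?case
    using theta_mean_identity[OF u] by (simp only: agm_seq.simps Suc sq) simp
qed simp

lemma agm_seq_theta_tendsto: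
  assumes "\<bar>q\<bar> < 1"
  shows "(\<lambda>n. fst (agm_seq ((theta q)\<^sup>2) ((theta (- q))\<^sup>2) n)) \<longlonglongrightarrow> 1"
    and "(\<lambda>n. snd (agm_seq ((theta q)\<^sup>2) ((theta (- q))\<^sup>2) n)) \<longlonglongrightarrow> 1"
proof -
  have lim: "(\<lambda>n. q ^ 2 ^ n) \<longlonglongrightarrow> 0" "(\<lambda>n. - (q ^ 2 ^ n)) \<longlonglongrightarrow> 0"
    using power_power_two_tendsto_0[OF assms] tendsto_minus by fastforce+
  show "(\<lambda>n. fst (agm_seq ((theta q)\<^sup>2) ((theta (- q))\<^sup>2) n)) \<longlonglongrightarrow> 1"
    using tendsto_power[OF theta_tendsto_1[OF lim(1)], of 2] by (simp add: agm_seq_theta[OF assms])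
  show "(\<lambda>n. snd (agm_seq ((theta q)\<^sup>2) ((theta (- q))\<^sup>2) n)) \<longlonglongrightarrow> 1"
    using tendsto_power[OF theta_tendsto_1[OF lim(2)], of 2] by (simp add: agm_seq_theta[OF assms])
qed

text \<open>
  A zero of theta would make all geometric means in the iteration vanish, whereas they
  tend to \<open>1\<close>.
\<close>

lemma theta_nonzero:
  assumes "\<bar>q\<bar> < 1"
  shows "theta q \<noteq> 0"
proof
  assume "theta q = 0"
  then have "snd (agm_seq ((theta (- q))\<^sup>2) ((theta q)\<^sup>2) n) = 0" for n
    by (induction n) (simp_all add: case_prod_unfold Let_def)
  moreover have "(\<lambda>n. snd (agm_seq ((theta (- q))\<^sup>2) ((theta q)\<^sup>2) n)) \<longlonglongrightarrow> 1"
    using agm_seq_theta_tendsto(2)[of "- q"] assms by simp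
  ultimately have "(\<lambda>n::nat. 0::real) \<longlonglongrightarrow> 1"
    by simp
  then show False
    using LIMSEQ_unique[OF _ tendsto_const[of "0::real"]] by fastforce
qed

lemma theta_positive:
  assumes "\<bar>q\<bar> < 1"
  shows "theta q > 0"
proof (rule ccontr)
  assume "\<not> theta q > 0"
  then have "0 \<in> closed_segment (theta q) (theta 0)"
    by (simp add: closed_segment_eq_real_ivl theta_0)
  moreover have "continuous_on (closed_segment q 0) theta"
    using assms by (intro continuous_on_subset[OF continuous_on_theta])
      (auto simp: closed_segment_eq_real_ivl split: if_splits)
  ultimately obtain p where "p \<in> closed_segment q 0" "theta p = 0"
    using IVT'_closed_segment_real by blast
  moreover from this have "\<bar>p\<bar> < 1"
    using assms by (auto simp: closed_segment_eq_real_ivl split: if_splits)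
  ultimately show False
    using theta_nonzero by blast
qed

text \<open>
  Homogeneity turns \<open>agm ((theta q)\<^sup>2) ((theta (- q))\<^sup>2) = 1\<close> into this relation. It says that \<open>q\<close> is
  the nome of the pair \<open>1\<close>, \<open>(theta (- q))\<^sup>2 / (theta q)\<^sup>2\<close>, which is why \<open>1\<close> is the unit of the operation.
\<close>

lemma agm_one_theta_ratio:
  assumes "\<bar>q\<bar> < 1"
  shows "agm 1 ((theta (- q))\<^sup>2 / (theta q)\<^sup>2) = 1 / (theta q)\<^sup>2"
proof -
  have pos: "theta q > 0" "theta (- q) > 0"
    using theta_positive[of q] theta_positive[of "- q"] assms by auto
  have "agm ((theta q)\<^sup>2) ((theta (- q))\<^sup>2) = 1"
    by (intro agm_eqI agm_seq_theta_tendsto assms)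
  moreover have "agm ((theta q)\<^sup>2 * 1) ((theta q)\<^sup>2 * ((theta (- q))\<^sup>2 / (theta q)\<^sup>2)) =
      (theta q)\<^sup>2 * agm 1 ((theta (- q))\<^sup>2 / (theta q)\<^sup>2)"
    using pos by (intro agm_scale) auto
  ultimately show ?thesis
    using pos by (simp add: field_simps)
qed

section \<open>Monotonicity of theta\<close>

lemma theta_strict_mono_nonneg:
  assumes "0 \<le> p" "p < q" "q < 1"
  shows "theta p < theta q"
proof -
  have sm: "summable (\<lambda>n. r ^ (Suc n)\<^sup>2)" if "r \<in> {p, q}" for r
    using summable_power_Suc_square[of r] assms that by (intro summable_norm_cancel[of "\<lambda>n. r ^ (Suc n)\<^sup>2"]) auto
  have "0 < (\<Sum>n. q ^ (Suc n)\<^sup>2 - p ^ (Suc n)\<^sup>2)"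
    using sm assms by (intro suminf_pos summable_diff) (auto intro!: power_strict_mono)
  also have "\<dots> = (\<Sum>n. q ^ (Suc n)\<^sup>2) - (\<Sum>n. p ^ (Suc n)\<^sup>2)"
    using sm by (intro suminf_diff[symmetric]) auto
  finally show ?thesis
    using assms by (simp add: theta_eq_suminf)
qed

text \<open>
  For negative nome the theta series alternates and monotonicity is not visible term by term.
  It is transported from positive nome by the agm: as \<open>theta\<close> grows on the positive side,
  \<open>agm 1\<close> of the quotient \<open>(theta (- q))\<^sup>2 / (theta q)\<^sup>2\<close> drops, hence so does the quotient; its reciprocal
  rises, and so does \<open>agm 1\<close> of it, which is \<open>1 / (theta (- q))\<^sup>2\<close>.
\<close>

lemma theta_minus_antimono_nonneg:
  assumes "0 \<le> p" "p < q" "q < 1"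
  shows "theta (- q) \<le> theta (- p)"
proof -
  have pos: "theta p > 0" "theta (- p) > 0" "theta q > 0" "theta (- q) > 0"
    using assms by (auto intro!: theta_positive)
  have lt: "theta p < theta q"
    using theta_strict_mono_nonneg assms by blast
  have "(theta (- q))\<^sup>2 / (theta q)\<^sup>2 < (theta (- p))\<^sup>2 / (theta p)\<^sup>2"
  proof (rule ccontr)
    assume "\<not> ?thesis"
    then have "agm 1 ((theta (- p))\<^sup>2 / (theta p)\<^sup>2) \<le> agm 1 ((theta (- q))\<^sup>2 / (theta q)\<^sup>2)"
      using pos by (intro agm_mono) auto
    then have "1 / (theta p)\<^sup>2 \<le> 1 / (theta q)\<^sup>2"
      using assms by (simp add: agm_one_theta_ratio)
    then have "(theta q)\<^sup>2 \<le> (theta p)\<^sup>2"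
      using pos by (simp add: field_simps)
    with lt pos show False
      by (simp add: power2_le_iff_abs_le)
  qed
  then have "(theta p)\<^sup>2 / (theta (- p))\<^sup>2 \<le> (theta q)\<^sup>2 / (theta (- q))\<^sup>2"
    using pos by (simp add: field_simps)
  then have "agm 1 ((theta p)\<^sup>2 / (theta (- p))\<^sup>2) \<le> agm 1 ((theta q)\<^sup>2 / (theta (- q))\<^sup>2)"
    using pos by (intro agm_mono) auto
  then have "1 / (theta (- p))\<^sup>2 \<le> 1 / (theta (- q))\<^sup>2"
    using agm_one_theta_ratio[of "- p"] agm_one_theta_ratio[of "- q"] assms by simp
  then have "(theta (- q))\<^sup>2 \<le> (theta (- p))\<^sup>2"
    using pos by (simp add: field_simps)
  then show ?thesis
    using pos by (simp add: power2_le_iff_abs_le)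
qed

text \<open>
  Strictness comes from \<open>theta (- q) = (theta (- (q\<^sup>2)))\<^sup>2 / theta q\<close>: the numerator does not
  increase and the denominator strictly increases.
\<close>

lemma theta_minus_strict_antimono_nonneg:
  assumes "0 \<le> p" "p < q" "q < 1"
  shows "theta (- q) < theta (- p)"
proof -
  have pos: "theta p > 0" "theta q > 0" "theta (- (q\<^sup>2)) > 0"
    using assms by (auto intro!: theta_positive simp: abs_square_less_1)
  have "p\<^sup>2 < q\<^sup>2" "q\<^sup>2 < 1"
    using assms by (auto simp: abs_square_less_1 power_strict_mono)
  then have "theta (- (q\<^sup>2)) \<le> theta (- (p\<^sup>2))"
    by (intro theta_minus_antimono_nonneg) auto
  then have "(theta (- (q\<^sup>2)))\<^sup>2 \<le> (theta (- (p\<^sup>2)))\<^sup>2"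
    using pos by (intro power_mono) auto
  then have "theta q * theta (- q) \<le> theta p * theta (- p)"
    using assms by (simp add: theta_mult_identity)
  also have "\<dots> < theta q * theta (- p)"
    using theta_strict_mono_nonneg[OF assms] theta_positive[of "- p"] assms by simp
  finally show ?thesis
    using pos by simp
qed

lemma theta_strict_mono:
  assumes "-1 < p" "p < q" "q < 1"
  shows "theta p < theta q"
proof -
  consider "0 \<le> p" | "q \<le> 0" | "p < 0" "0 < q"
    by linarith
  then show ?thesis
  proof cases
    case 1
    then show ?thesis using assms theta_strict_mono_nonneg by blast
  next
    case 2
    then show ?thesis using assms theta_minus_strict_antimono_nonneg[of "- q" "- p"] by simp
  next
    case 3
    then have "theta p < theta 0" "theta 0 < theta q"
      using assms theta_minus_strict_antimono_nonneg[of 0 "- p"] theta_strict_mono_nonneg[of 0 q] by auto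
    then show ?thesis by simp
  qed
qed

lemma theta_inj:
  assumes "\<bar>p\<bar> < 1" "\<bar>q\<bar> < 1" "theta p = theta q"
  shows "p = q"
  using assms theta_strict_mono[of p q] theta_strict_mono[of q p]
  by (cases p q rule: linorder_cases) (auto simp: abs_less_iff)

section \<open>Surjectivity of theta and of the quotient of theta values\<close>

lemma theta_unbounded:
  "\<exists>q. 0 \<le> q \<and> q < 1 \<and> M \<le> theta q"
proof -
  obtain k :: nat where "M \<le> real k"
    using real_arch_simple by blast
  then obtain N :: nat where N: "M \<le> real N" "N > 0"
    by (intro that[of "Suc k"]) auto
  \<comment> \<open>At this point each of the first \<open>N\<close> powers in the series is still at least \<open>1 / 2\<close>.\<close>
  define q where "q = root (N\<^sup>2) (1 / 2)"
  have q: "0 \<le> q" "q < 1" "q ^ N\<^sup>2 = 1 / 2"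
    using N by (auto simp: q_def real_root_pow_pos2)
  have "real N \<le> 1 + 2 * (\<Sum>n<N. 1 / 2 :: real)"
    by simp
  also have "(\<Sum>n<N. 1 / 2 :: real) \<le> (\<Sum>n<N. q ^ (Suc n)\<^sup>2)"
  proof (rule sum_mono)
    fix n assume "n \<in> {..<N}"
    then have "q ^ N\<^sup>2 \<le> q ^ (Suc n)\<^sup>2"
      using q by (intro power_decreasing power_mono) auto
    then show "1 / 2 \<le> q ^ (Suc n)\<^sup>2"
      using q by simp
  qed
  also have "\<dots> \<le> (\<Sum>n. q ^ (Suc n)\<^sup>2)"
    using q summable_power_Suc_square[of q] by (intro sum_le_suminf) auto
  also have "1 + 2 * \<dots> = theta q"
    using q by (simp add: theta_eq_suminf)
  finally show ?thesis
    using q N by auto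
qed

text \<open>
  This bound derives the decay of theta at \<open>-1\<close> from its growth at \<open>1\<close>.
\<close>

lemma theta_minus_le_inverse:
  assumes "0 \<le> q" "q < 1"
  shows "theta (- q) \<le> 1 / theta q"
proof -
  have "theta (- (q\<^sup>2)) \<le> 1"
  proof (cases "q = 0")
    case False
    then show ?thesis
      using theta_strict_mono[of "- (q\<^sup>2)" 0] assms by (simp add: theta_0 abs_square_less_1)
  qed (simp add: theta_0)
  then have "(theta (- (q\<^sup>2)))\<^sup>2 \<le> 1"
    using theta_positive[of "- (q\<^sup>2)"] assms by (intro power_le_one) (auto simp: abs_square_less_1)
  then have "theta q * theta (- q) \<le> 1"
    using assms by (simp add: theta_mult_identity)
  then show ?thesis
    using theta_positive[of q] assms by (simp add: field_simps)
qed

text \<open>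
  A symmetric interval \<open>{- q..q}\<close> large enough for the intermediate value theorem, both for
  theta and for the quotient \<open>theta (- q) / theta q\<close>. The two comparisons with \<open>1\<close> are what the
  quotient needs.
\<close>

lemma theta_straddle:
  assumes "w > 0"
  obtains q where "0 \<le> q" "q < 1" "theta (- q) \<le> w" "w \<le> theta q" "1 \<le> theta q" "theta (- q) \<le> 1"
proof -
  obtain q where q: "0 \<le> q" "q < 1" "max 1 (max w (1 / w)) \<le> theta q"
    using theta_unbounded by blast
  have inv: "theta (- q) \<le> 1 / theta q"
    using theta_minus_le_inverse q by blast
  have "1 / theta q \<le> w" "1 / theta q \<le> 1"
    using q assms by (auto simp: field_simps)
  with inv q that show thesis
    by (meson max.bounded_iff order_trans)
qed

lemma theta_surj:
  assumes "w > 0"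
  shows "\<exists>q. \<bar>q\<bar> < 1 \<and> theta q = w"
proof -
  obtain q where q: "0 \<le> q" "q < 1" "theta (- q) \<le> w" "w \<le> theta q"
    using theta_straddle[OF assms] by metis
  have "continuous_on {- q..q} theta"
    using q by (intro continuous_on_subset[OF continuous_on_theta]) auto
  then obtain p where "- q \<le> p" "p \<le> q" "theta p = w"
    using IVT'[of theta "- q" w q] q by auto
  then show ?thesis
    using q by (intro exI[of _ p]) auto
qed

lemma theta_ratio_surj:
  assumes "w > 0"
  shows "\<exists>q. \<bar>q\<bar> < 1 \<and> theta (- q) / theta q = w"
proof -
  obtain q where q: "0 \<le> q" "q < 1" "theta (- q) \<le> w" "w \<le> theta q" "1 \<le> theta q"
    "theta (- q) \<le> 1"
    using theta_straddle[OF assms] by metis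
  have pos: "theta r > 0" "theta (- r) > 0" if "r \<in> {- q..q}" for r
    using q that by (auto intro!: theta_positive)
  have "continuous_on {- q..q} theta"
    using q by (intro continuous_on_subset[OF continuous_on_theta]) auto
  moreover have "continuous_on {- q..q} (\<lambda>r. theta (- r))"
    using q by (intro continuous_on_compose2[OF continuous_on_theta]) (auto intro!: continuous_intros)
  ultimately have "continuous_on {- q..q} (\<lambda>r. theta (- r) / theta r)"
    using pos(1) by (intro continuous_on_divide) force+
  moreover have "theta (- q) / theta q \<le> w"
  proof -
    have "theta (- q) / theta q \<le> theta (- q) / 1"
      using q pos[of q] by (intro divide_left_mono) auto
    with q show ?thesis by simp
  qed
  moreover have "w \<le> theta (- (- q)) / theta (- q)"
  proof -
    have "theta q / 1 \<le> theta q / theta (- q)"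
      using q pos[of q] by (intro divide_left_mono) auto
    with q show ?thesis by simp
  qed
  ultimately obtain p where "- q \<le> p" "p \<le> q" "theta (- p) / theta p = w"
    using IVT2'[of "\<lambda>r. theta (- r) / theta r" q w "- q"] q by auto
  then show ?thesis
    using q by (intro exI[of _ p]) auto
qed

text \<open>
  Theta increases, so the numerator decreases and the denominator increases.
\<close>

lemma theta_ratio_inj:
  assumes "\<bar>p\<bar> < 1" "\<bar>q\<bar> < 1" "(theta (- p))\<^sup>2 / (theta p)\<^sup>2 = (theta (- q))\<^sup>2 / (theta q)\<^sup>2"
  shows "p = q"
proof -
  have less: "(theta (- s))\<^sup>2 / (theta s)\<^sup>2 < (theta (- r))\<^sup>2 / (theta r)\<^sup>2"
    if "r < s" "\<bar>r\<bar> < 1" "\<bar>s\<bar> < 1" for r s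
  proof -
    have "theta r < theta s" "theta (- s) < theta (- r)"
      using that by (auto intro!: theta_strict_mono)
    moreover have "theta r > 0" "theta (- s) > 0"
      using that by (auto intro!: theta_positive)
    ultimately show ?thesis
      by (intro frac_less power_mono power_strict_mono zero_less_power) auto
  qed
  show ?thesis
    using less[of p q] less[of q p] assms by (metis less_irrefl linorder_neqE)
qed

section \<open>The operation on positive reals\<close>

lemma agm_nome_eqI:
  assumes "\<bar>q\<bar> < 1" "1 / agm x y = (theta q)\<^sup>2"
  shows "agm_nome x y = q"
  unfolding agm_nome_def
proof (rule the_equality)
  show "-1 < q \<and> q < 1 \<and> 1 / agm x y = (theta q)\<^sup>2"
    using assms by auto
next
  fix p
  assume p: "-1 < p \<and> p < 1 \<and> 1 / agm x y = (theta p)\<^sup>2"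
  then have "(theta p)\<^sup>2 = (theta q)\<^sup>2"
    using assms(2) by (elim conjE) (rule trans[OF sym])
  moreover have bound: "\<bar>p\<bar> < 1"
    using p by (simp add: abs_less_iff)
  ultimately have "theta p = theta q"
    using theta_positive[OF bound] theta_positive[OF assms(1)] by (simp add: power2_eq_iff_nonneg)
  then show "p = q"
    by (rule theta_inj[OF bound assms(1)])
qed

lemma
  assumes "x > 0" "y > 0"
  shows agm_nome_bound: "\<bar>agm_nome x y\<bar> < 1"
    and theta_agm_nome: "(theta (agm_nome x y))\<^sup>2 = 1 / agm x y"
proof -
  obtain q where q: "\<bar>q\<bar> < 1" "theta q = sqrt (1 / agm x y)"
    using theta_surj[of "sqrt (1 / agm x y)"] agm_positive[OF assms] by auto
  then have "1 / agm x y = (theta q)\<^sup>2"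
    using agm_positive[OF assms] by simp
  with agm_nome_eqI[OF q(1) this] q(1)
  show "\<bar>agm_nome x y\<bar> < 1" "(theta (agm_nome x y))\<^sup>2 = 1 / agm x y"
    by auto
qed

lemma agm_star_positive:
  assumes "x > 0" "y > 0"
  shows "x \<star> y > 0"
  unfolding agm_star_def using agm_nome_bound[OF assms]
  by (intro divide_pos_pos zero_less_power theta_positive) auto

text \<open>
  The operation sees its arguments only through their agm. Commutativity, and the fact that
  the agm is the mean of the operation, follow from this alone.
\<close>

lemma agm_star_cong: "agm x y = agm x' y' \<Longrightarrow> x \<star> y = x' \<star> y'"
  by (simp add: agm_star_def agm_nome_def)

lemma agm_star_one_left:
  assumes "x > 0"
  shows "1 \<star> x = x"
proof -
  obtain q where q: "\<bar>q\<bar> < 1" "theta (- q) / theta q = sqrt x"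
    using theta_ratio_surj[of "sqrt x"] assms by auto
  then have x: "x = (theta (- q))\<^sup>2 / (theta q)\<^sup>2"
    using assms by (simp flip: power_divide)
  then have "agm_nome 1 x = q"
    using agm_one_theta_ratio[OF q(1)] q(1) by (intro agm_nome_eqI) (simp_all flip: x)
  then show ?thesis
    unfolding agm_star_def using x by metis
qed

lemma agm_star_diagonal_inj:
  assumes "x > 0" "y > 0" "x \<star> x = y \<star> y"
  shows "x = y"
proof -
  have "agm_nome x x = agm_nome y y"
    using assms by (intro theta_ratio_inj[OF agm_nome_bound agm_nome_bound]) (simp_all add: agm_star_def)
  then have "1 / agm x x = 1 / agm y y"
    using theta_agm_nome[of x x] theta_agm_nome[of y y] assms by simp
  then show ?thesis
    using assms by (simp add: agm_same)
qed

lemma agm_star_diagonal_agm: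
  assumes "x > 0" "y > 0"
  shows "x \<star> y = agm x y \<star> agm x y"
  by (rule agm_star_cong) (simp add: agm_same agm_positive assms)

theorem theorem1:
  "(\<forall>x>0. \<forall>y>0. x \<star> y > 0) \<and>
   (\<forall>x>0. 1 \<star> x = x) \<and>
   (\<forall>e>0. (\<forall>x>0. e \<star> x = x \<and> x \<star> e = x) \<longleftrightarrow> e = 1) \<and>
   (\<forall>x>0. \<forall>y>0. x \<star> x = y \<star> y \<longrightarrow> x = y) \<and>
   (\<forall>x>0. \<forall>y>0. x \<star> y = agm x y \<star> agm x y) \<and>
   (\<forall>x>0. \<forall>y>0. \<forall>\<mu>. (\<mu> > 0 \<and> x \<star> y = \<mu> \<star> \<mu>) \<longleftrightarrow> \<mu> = agm x y)"
proof (intro conjI allI impI)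
  fix e :: real
  assume e: "e > 0"
  show "(\<forall>x>0. e \<star> x = x \<and> x \<star> e = x) \<longleftrightarrow> e = 1"
  proof
    assume "\<forall>x>0. e \<star> x = x \<and> x \<star> e = x"
    then have "1 \<star> e = 1" by simp
    then show "e = 1" using agm_star_one_left[OF e] by simp
  next
    assume "e = 1"
    then show "\<forall>x>0. e \<star> x = x \<and> x \<star> e = x"
      using agm_star_one_left agm_star_cong[OF agm_commute] by (metis zero_less_one)
  qed
next
  fix x y \<mu> :: real
  assume "x > 0" "y > 0"
  then show "(\<mu> > 0 \<and> x \<star> y = \<mu> \<star> \<mu>) \<longleftrightarrow> \<mu> = agm x y"
    using agm_star_diagonal_agm agm_star_diagonal_inj agm_positive by metis
qed (rule agm_star_positive agm_star_one_left agm_star_diagonal_inj agm_star_diagonal_agm; assumption)+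

end
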